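(* Let $L$ be an infinite locally compact Hausdorff topological space, and let $\mathcal{A}$ be a somewhat regular closed linear subspace of $C_0(L)$. Then, whenever $0<\varepsilon<1$, there is an $\varepsilon$-isometry from $c_0$ onto a closed linear subspace of $\mathcal{A}$.
   Context: $\mathbb{K}$ denotes either $\mathbb{R}$ or $\mathbb{C}$, $C_0(L)$ is the Banach space of continuous $\mathbb{K}$-valued functions on $L$ vanishing at infinity, with the supremum norm, and $c_0$ is the Banach space of $\mathbb{K}$-valued null sequences with the supremum norm. A linear subspace $\mathcal{A}$ of $C_0(L)$ is called somewhat regular if, whenever $V$ is a non-empty open subset of $L$ and $0<\varepsilon<1$, there is an $f\in\mathcal{A}$ such that $\|f\|=1$ and $|f(x)|\leq\varepsilon$ for every $x\in L\setminus V$. For normed spaces $X$, $Y$ and $0<\varepsilon<1$, a linear surjection $T\colon X\to Y$ is called an $\varepsilon$-isometry if $(1-\varepsilon)\|x\|\leq\|Tx\|\leq(1+\varepsilon)\|x\|$ for every $x\in X$. *)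

theory Defs
  imports "HOL-Analysis.Analysis"
begin

text \<open>
  The library makes \<open>'a \<Rightarrow>\<^sub>C 'k\<close> a vector space over the reals only;
  for \<open>'k = complex\<close> linearity over \<open>'k\<close> needs the following scaling.
\<close>

definition kscale ::
    "'k::real_normed_field \<Rightarrow> ('a::topological_space \<Rightarrow>\<^sub>C 'k) \<Rightarrow> ('a \<Rightarrow>\<^sub>C 'k)" where
  "kscale c f = Bcontfun (\<lambda>x. c * apply_bcontfun f x)"

lemma apply_bcontfun_kscale: "apply_bcontfun (kscale c f) x = c * apply_bcontfun f x"
proof -
  have "bounded ((\<lambda>y. c * y) ` range (apply_bcontfun f))"
    by (intro bounded_linear_image bounded_linear_mult_right) simp
  then have "(\<lambda>x. c * apply_bcontfun f x) \<in> bcontfun"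
    by (auto simp: bcontfun_def image_image intro: continuous_intros)
  then show ?thesis
    by (simp add: kscale_def Bcontfun_inverse)
qed

lemma vector_space_kscale:
  "vector_space (kscale :: 'k::real_normed_field \<Rightarrow> ('a::topological_space \<Rightarrow>\<^sub>C 'k) \<Rightarrow> _)"
  by standard (auto intro!: bcontfun_eqI simp: apply_bcontfun_kscale algebra_simps)

definition C0 :: "('a::topological_space \<Rightarrow>\<^sub>C 'k::real_normed_field) set" where
  "C0 = {f. \<forall>e>0. \<exists>K. compact K \<and> (\<forall>x. x \<notin> K \<longrightarrow> norm (apply_bcontfun f x) < e)}"

text \<open>
  The topology of the type \<^typ>\<open>nat\<close> is discrete and null sequences are bounded, so
  every null sequence occurs as an element of the following set.
\<close>

definition c0 :: "(nat \<Rightarrow>\<^sub>C 'k::real_normed_field) set" where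
  "c0 = {x. (\<lambda>n. apply_bcontfun x n) \<longlonglongrightarrow> 0}"

definition linear_subspace_of ::
    "('a::topological_space \<Rightarrow>\<^sub>C 'k::real_normed_field) set \<Rightarrow> ('a \<Rightarrow>\<^sub>C 'k) set \<Rightarrow> bool" where
  "linear_subspace_of Y X \<longleftrightarrow> Y \<subseteq> X \<and> module.subspace kscale Y"

definition closed_linear_subspace_of ::
    "('a::topological_space \<Rightarrow>\<^sub>C 'k::real_normed_field) set \<Rightarrow> ('a \<Rightarrow>\<^sub>C 'k) set \<Rightarrow> bool" where
  "closed_linear_subspace_of Y X \<longleftrightarrow> linear_subspace_of Y X \<and> closedin (top_of_set X) Y"

definition somewhat_regular ::
    "('a::topological_space \<Rightarrow>\<^sub>C 'k::real_normed_field) set \<Rightarrow> bool" where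
  "somewhat_regular A \<longleftrightarrow> linear_subspace_of A C0 \<and>
    (\<forall>V \<epsilon>. open V \<and> V \<noteq> {} \<and> 0 < \<epsilon> \<and> \<epsilon> < 1 \<longrightarrow>
      (\<exists>f\<in>A. norm f = 1 \<and> (\<forall>x. x \<notin> V \<longrightarrow> norm (apply_bcontfun f x) \<le> \<epsilon>)))"

text \<open>
  The normed spaces \<open>X\<close> and \<open>Y\<close> are linear subspaces of spaces of bounded continuous
  functions, and only the values of \<open>T\<close> on \<open>X\<close> matter.
\<close>

definition eps_isometry ::
    "real \<Rightarrow> ('b::topological_space \<Rightarrow>\<^sub>C 'k::real_normed_field) set \<Rightarrow>
      ('a::topological_space \<Rightarrow>\<^sub>C 'k) set \<Rightarrow> (('b \<Rightarrow>\<^sub>C 'k) \<Rightarrow> ('a \<Rightarrow>\<^sub>C 'k)) \<Rightarrow> bool" where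
  "eps_isometry \<epsilon> X Y T \<longleftrightarrow>
    (\<forall>x\<in>X. \<forall>y\<in>X. T (x + y) = T x + T y) \<and>
    (\<forall>c. \<forall>x\<in>X. T (kscale c x) = kscale c (T x)) \<and>
    T ` X = Y \<and>
    (\<forall>x\<in>X. (1 - \<epsilon>) * norm x \<le> norm (T x) \<and> norm (T x) \<le> (1 + \<epsilon>) * norm x)"

end

theory Submission
  imports Defs
begin

text \<open>
  Choose pairwise disjoint non-empty open sets \<open>V n\<close> and functions \<open>f n \<in> A\<close> of norm 1 with
  \<open>\<bar>f n\<bar> \<le> \<epsilon> / 2 ^ (n + 1)\<close> off \<open>V n\<close>, and put \<open>T x = (\<Sum>n. x n * f n)\<close>. At each point of \<open>L\<close>
  all but one of the \<open>\<bar>f n\<bar>\<close> are small, with sum at most \<open>\<epsilon>\<close>, so every partial sum has norm at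
  most \<open>(1 + \<epsilon>) * norm x\<close>; near a point where \<open>\<bar>f m\<bar>\<close> attains its norm the other terms contribute
  at most \<open>\<epsilon> * norm x\<close>, so \<open>norm (T x) \<ge> \<bar>x m\<bar> - \<epsilon> * norm x\<close> for every \<open>m\<close>. The lower bound
  and the completeness of \<open>c0\<close> make the range of \<open>T\<close> closed.
\<close>

section \<open>Scaling and completeness for bounded continuous functions\<close>

interpretation kscale: vector_space "kscale :: 'k::real_normed_field 
    \<Rightarrow> ('x::topological_space \<Rightarrow>\<^sub>C 'k) \<Rightarrow> _"
  by (rule vector_space_kscale)

lemma apply_bcontfun_sum:
  fixes f :: "'i \<Rightarrow> 'a::topological_space \<Rightarrow>\<^sub>C 'b::real_normed_vector"
  shows "apply_bcontfun (\<Sum>i\<in>S. f i) t = (\<Sum>i\<in>S. apply_bcontfun (f i) t)"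
  by (induction S rule: infinite_finite_induct) auto

lemma norm_kscale: "norm (kscale c f) = norm c * norm f"
proof (rule antisym)
  show "norm (kscale c f) \<le> norm c * norm f"
    by (rule norm_bound)
      (simp add: apply_bcontfun_kscale norm_mult mult_left_mono norm_bounded)
  show "norm c * norm f \<le> norm (kscale c f)"
  proof (cases "c = 0")
    case False
    have "norm f \<le> norm (kscale c f) / norm c"
    proof (rule norm_bound)
      fix x
      have "norm c * norm (apply_bcontfun f x) \<le> norm (kscale c f)"
        using norm_bounded[of "kscale c f" x] by (simp add: apply_bcontfun_kscale norm_mult)
      then show "norm (apply_bcontfun f x) \<le> norm (kscale c f) / norm c"
        using False by (simp add: field_simps)
    qed
    then show ?thesis
      using False by (simp add: field_simps)
  qed simp
qed

text \<open>Continuity of scaling lets it pass through infinite sums.\<close>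

lemma bounded_linear_kscale: "bounded_linear (kscale c)"
proof (rule bounded_linear_intro)
  show "kscale c (r *\<^sub>R f) = r *\<^sub>R kscale c f" for r f
    by (rule bcontfun_eqI) (simp add: apply_bcontfun_kscale)
  show "norm (kscale c f) \<le> norm f * norm c" for f
    by (simp add: norm_kscale mult.commute)
qed (rule kscale.scale_right_distrib)

text \<open>
  The library's completeness instance for \<open>'a \<Rightarrow>\<^sub>C 'b\<close> needs a metric space \<open>'a\<close>.
\<close>

lemma Cauchy_convergent_bcontfun:
  fixes F :: "nat \<Rightarrow> 'a::topological_space \<Rightarrow>\<^sub>C 'b::complete_space"
  assumes "Cauchy F"
  shows "convergent F"
proof -
  have "uniformly_Cauchy_on UNIV (\<lambda>n. apply_bcontfun (F n))"
    using assms dist_fun_lt_imp_dist_val_lt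
    unfolding Cauchy_def uniformly_Cauchy_on_def by metis
  then obtain l where "uniform_limit UNIV (\<lambda>n. apply_bcontfun (F n)) l sequentially"
    using Cauchy_uniformly_convergent uniformly_convergent_on_def by blast
  then obtain l' where "l = apply_bcontfun l'" "(F \<longlongrightarrow> l') sequentially"
    using uniform_limit_bcontfunE[of F l sequentially] by auto
  then show ?thesis
    by (auto simp: convergent_def)
qed

section \<open>The closed subspaces \<open>C0\<close> and \<open>c0\<close>\<close>

text \<open>A compact set outside which a uniformly close \<open>F n\<close> is below
  \<open>e / 2\<close> also works for the limit and \<open>e\<close>.\<close>

lemma closed_C0:
  "closed (C0 :: ('a::topological_space \<Rightarrow>\<^sub>C 'k::real_normed_field) set)"
  unfolding closed_sequential_limits
proof (intro allI impI)
  fix F and l :: "'a \<Rightarrow>\<^sub>C 'k"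
  assume F: "(\<forall>n. F n \<in> C0) \<and> F \<longlonglongrightarrow> l"
  show "l \<in> C0"
    unfolding C0_def
  proof (intro CollectI allI impI)
    fix e :: real
    assume "e > 0"
    then obtain n where n: "dist (F n) l < e / 2"
      using F by (meson LIMSEQ_def half_gt_zero order_refl)
    obtain K where K: "compact K" "\<And>x. x \<notin> K \<Longrightarrow> norm (apply_bcontfun (F n) x) < e / 2"
      using F half_gt_zero[OF \<open>e > 0\<close>] unfolding C0_def by blast
    have "norm (apply_bcontfun l x) < e" if "x \<notin> K" for x
      using dist_fun_lt_imp_dist_val_lt[OF n, of x] K(2)[OF that]
        norm_triangle_ineq3[of "apply_bcontfun (F n) x" "apply_bcontfun l x"]
      by (simp add: dist_norm)
    with K(1) show "\<exists>K. compact K \<and> (\<forall>x. x \<notin> K \<longrightarrow> norm (apply_bcontfun l x) < e)"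
      by blast
  qed
qed

lemma closed_c0: "closed (c0 :: (nat \<Rightarrow>\<^sub>C 'k::real_normed_field) set)"
  unfolding closed_sequential_limits
proof (intro allI impI)
  fix F and l :: "nat \<Rightarrow>\<^sub>C 'k"
  assume F: "(\<forall>n. F n \<in> c0) \<and> F \<longlonglongrightarrow> l"
  show "l \<in> c0"
    unfolding c0_def mem_Collect_eq
  proof (rule LIMSEQ_I)
    fix e :: real
    assume "e > 0"
    then obtain n where n: "dist (F n) l < e / 2"
      using F by (meson LIMSEQ_def half_gt_zero order_refl)
    obtain N where N: "\<And>k. k \<ge> N \<Longrightarrow> norm (apply_bcontfun (F n) k) < e / 2"
      using F LIMSEQ_D[of "apply_bcontfun (F n)" 0 "e / 2"] \<open>e > 0\<close> by (auto simp: c0_def)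
    have "norm (apply_bcontfun l k) < e" if "k \<ge> N" for k
      using dist_fun_lt_imp_dist_val_lt[OF n, of k] N[OF that]
        norm_triangle_ineq3[of "apply_bcontfun (F n) k" "apply_bcontfun l k"]
      by (simp add: dist_norm)
    then show "\<exists>N. \<forall>k\<ge>N. norm (apply_bcontfun l k - 0) < e"
      by auto
  qed
qed

lemma subspace_c0: "kscale.subspace c0"
proof -
  have "apply_bcontfun (kscale c x) = (\<lambda>n. c * apply_bcontfun x n)" for c and x :: "nat \<Rightarrow>\<^sub>C 'a"
    by (rule ext) (rule apply_bcontfun_kscale)
  then show ?thesis
    by (intro kscale.subspaceI)
      (auto simp: c0_def intro: tendsto_add_zero tendsto_mult_right_zero)
qed

section \<open>Disjoint open sets in an infinite Hausdorff space\<close>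

text \<open>A non-empty open set can be split off an infinite open set so that an infinite open
  remainder is left; this is iterated on the remainder.\<close>

lemma infinite_disjoint_open_sets:
  assumes "infinite (UNIV :: 'a::t2_space set)"
  obtains V :: "nat \<Rightarrow> 'a::t2_space set"
  where "\<And>n. open (V n)" "\<And>n. V n \<noteq> {}" "disjoint_family V"
proof -
  have split: "\<exists>V W. open V \<and> V \<noteq> {} \<and> open W \<and> infinite W \<and> V \<union> W \<subseteq> U \<and> V \<inter> W = {}"
    if "open U" "infinite U" for U :: "'a set"
  proof -
    obtain x y where xy: "x \<in> U" "y \<in> U" "x \<noteq> y"
      using \<open>infinite U\<close> by (metis finite.simps insertI1 subsetI finite_subset)
    then obtain P Q where PQ: "open P" "open Q" "x \<in> P" "y \<in> Q" "P \<inter> Q = {}"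
      using hausdorff by metis
    show ?thesis
    \<comment> \<open>If \<open>Q \<inter> U\<close> is infinite, it is the remainder and
      \<open>P \<inter> U\<close>, which contains \<open>x\<close>, is split off. Otherwise
      \<open>y\<close> is isolated and \<open>{y}\<close> is split off.\<close>
    proof (cases "infinite (Q \<inter> U)")
      case True
      then show ?thesis
        using PQ xy \<open>open U\<close> by (intro exI[of _ "P \<inter> U"] exI[of _ "Q \<inter> U"]) auto
    next
      case False
      \<comment> \<open>a finite open set of a Hausdorff space consists of isolated points\<close>
      then have "open (Q \<inter> U - (Q \<inter> U - {y}))"
        using PQ(2) \<open>open U\<close> by (intro open_Diff finite_imp_closed open_Int) auto
      also have "Q \<inter> U - (Q \<inter> U - {y}) = {y}"
        using PQ xy by auto
      finally show ?thesis
        using that xy by (intro exI[of _ "{y}"] exI[of _ "U - {y}"]) (auto intro: open_Diff)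
    qed
  qed
  \<comment> \<open>In a pair, \<open>V\<close> is the set just split off and \<open>W\<close> the
    remainder to be split next.\<close>
  define P where "P = (\<lambda>(V :: 'a set, W :: 'a set). open V \<and> V \<noteq> {} \<and> open W \<and> infinite W \<and> V \<inter> W = {})"
  have "\<exists>p. \<forall>n. P (p n) \<and> fst (p (Suc n)) \<union> snd (p (Suc n)) \<subseteq> snd (p n)"
  proof (rule dependent_nat_choice)
    show "\<exists>p. P p"
      using split[OF open_UNIV assms] unfolding P_def by auto
    show "\<exists>q. P q \<and> fst q \<union> snd q \<subseteq> snd p" if "P p" for p and n :: nat
    proof -
      have "open (snd p)" "infinite (snd p)"
        using that by (auto simp: P_def)
      from split[OF this] obtain V W where "open V" "V \<noteq> {}" "open W" "infinite W"
        "V \<union> W \<subseteq> snd p" "V \<inter> W = {}"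
        by blast
      then show ?thesis
        by (intro exI[of _ "(V, W)"]) (simp add: P_def)
    qed
  qed
  then obtain p where p: "\<And>n. P (p n)" "\<And>n. fst (p (Suc n)) \<union> snd (p (Suc n)) \<subseteq> snd (p n)"
    by metis
  \<comment> \<open>Remainders decrease, so every later set lies in \<open>snd (p m)\<close>, which
    misses \<open>fst (p m)\<close>.\<close>
  have anti: "snd (p n) \<subseteq> snd (p m)" if "m \<le> n" for m n
    by (rule lift_Suc_antimono_le[OF _ that]) (use p(2) in auto)
  have "fst (p m) \<inter> fst (p n) = {}" if less: "m < n" for m n
  proof -
    obtain k where "n = Suc k" "m \<le> k"
      using less_imp_Suc_add[OF less] le_add1 by blast
    then have "fst (p n) \<subseteq> snd (p m)"
      using p(2)[of k] anti[of m k] by auto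
    moreover have "fst (p m) \<inter> snd (p m) = {}"
      using p(1)[of m] by (auto simp: P_def)
    ultimately show ?thesis
      by blast
  qed
  then have "disjoint_family (\<lambda>n. fst (p n))"
    unfolding disjoint_family_on_def by (metis Int_commute linorder_neqE_nat)
  moreover have "open (fst (p n))" "fst (p n) \<noteq> {}" for n
    using p(1)[of n] by (auto simp: P_def)
  ultimately show thesis
    by (intro that[of "\<lambda>n. fst (p n)"])
qed

section \<open>Norm estimates for finite sums of almost disjoint functions\<close>

text \<open>Of the disjoint open sets only \<open>large_unique\<close> is kept: at each point at
  most one \<open>f n\<close> exceeds its threshold \<open>d n\<close>.\<close>

locale almost_disjoint =
  fixes f :: "nat \<Rightarrow> 'a::topological_space \<Rightarrow>\<^sub>C 'k::{real_normed_field, banach}"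
    and d :: "nat \<Rightarrow> real" and \<epsilon> :: real
  assumes norm_f: "norm (f n) = 1"
    and d_nonneg: "0 \<le> d n" and d_less: "d n < 1" and d_sums: "d sums \<epsilon>"
    and large_unique: "\<lbrakk>d m < norm (apply_bcontfun (f m) t); d n < norm (apply_bcontfun (f n) t)\<rbrakk> \<Longrightarrow> m = n"
    and \<epsilon>_less: "\<epsilon> < 1"
begin

lemma \<epsilon>_nonneg: "0 \<le> \<epsilon>"
  by (rule sums_le[OF _ sums_zero d_sums]) (rule d_nonneg)

lemma small_off:
  assumes "d m < norm (apply_bcontfun (f m) t)" "n \<noteq> m"
  shows "norm (apply_bcontfun (f n) t) \<le> d n"
  using assms large_unique not_le by blast

lemma sum_d_le: "finite S \<Longrightarrow> sum d S \<le> \<epsilon>"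
  using d_sums d_nonneg by (metis sum_le_suminf sums_iff)

text \<open>Bounds the off-peak terms in both estimates below.\<close>

lemma sum_norm_small_le:
  assumes "finite S" "\<And>n. n \<in> S \<Longrightarrow> norm (x n) \<le> M" "M \<ge> 0"
    and "\<And>n. n \<in> S \<Longrightarrow> norm (apply_bcontfun (f n) t) \<le> d n"
  shows "norm (\<Sum>n\<in>S. x n * apply_bcontfun (f n) t) \<le> M * \<epsilon>"
proof -
  have "norm (\<Sum>n\<in>S. x n * apply_bcontfun (f n) t) \<le> (\<Sum>n\<in>S. M * d n)"
    using assms by (intro sum_norm_le) (auto simp: norm_mult intro: mult_mono)
  also have "\<dots> \<le> M * \<epsilon>"
    using sum_d_le[OF assms(1)] assms(3) by (simp add: mult_left_mono flip: sum_distrib_left)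
  finally show ?thesis .
qed

text \<open>At each point the one possible large term is at most \<open>M\<close> and the others add
  at most \<open>M * \<epsilon>\<close>. Allowing any finite \<open>S\<close> covers the blocks
  \<open>{m..<n}\<close> of the later Cauchy argument.\<close>

lemma norm_sum_le:
  assumes "finite S" "\<And>n. n \<in> S \<Longrightarrow> norm (x n) \<le> M" "M \<ge> 0"
  shows "norm (\<Sum>n\<in>S. kscale (x n) (f n)) \<le> (1 + \<epsilon>) * M"
proof (rule norm_bound)
  fix t
  let ?g = "\<lambda>n. x n * apply_bcontfun (f n) t"
  have "norm (sum ?g S) \<le> (1 + \<epsilon>) * M"
  proof (cases "\<exists>m\<in>S. d m < norm (apply_bcontfun (f m) t)")
    case True
    then obtain m where m: "m \<in> S" "d m < norm (apply_bcontfun (f m) t)"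
      by blast
    have "norm (sum ?g (S - {m})) \<le> M * \<epsilon>"
      using assms small_off[OF m(2)] by (intro sum_norm_small_le) auto
    moreover have "norm (?g m) \<le> M * 1"
      unfolding norm_mult using assms m(1) norm_bounded[of "f m" t] norm_f
      by (intro mult_mono) auto
    moreover have "sum ?g S = ?g m + sum ?g (S - {m})"
      using assms(1) m(1) by (rule sum.remove)
    ultimately show ?thesis
      using norm_triangle_ineq[of "?g m" "sum ?g (S - {m})"] by (simp add: algebra_simps)
  next
    case False
    then have "norm (sum ?g S) \<le> M * \<epsilon>"
      using assms by (intro sum_norm_small_le) (auto simp: not_less)
    then show ?thesis
      using assms(3) by (simp add: algebra_simps)
  qed
  then show "norm (apply_bcontfun (\<Sum>n\<in>S. kscale (x n) (f n)) t) \<le> (1 + \<epsilon>) * M"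
    by (simp add: apply_bcontfun_sum apply_bcontfun_kscale)
qed

lemma norm_sum_ge:
  assumes "finite S" "m \<in> S" "\<And>n. n \<in> S \<Longrightarrow> norm (x n) \<le> M"
  shows "norm (x m) - M * \<epsilon> \<le> norm (\<Sum>n\<in>S. kscale (x n) (f n))"
proof -
  let ?N = "norm (\<Sum>n\<in>S. kscale (x n) (f n))"
  have M: "M \<ge> 0"
    using assms(2,3) norm_ge_zero order_trans by blast
  \<comment> \<open>Here \<open>f m\<close> is only bounded and need not attain its norm, so it is
    evaluated where it exceeds some \<open>c\<close> below 1.\<close>
  have *: "norm (x m) * c \<le> ?N + M * \<epsilon>" if c: "d m < c" "c < 1" for c
  proof -
    have "\<not> (\<forall>t. norm (apply_bcontfun (f m) t) \<le> c)"
      using norm_bound[of "f m" c] norm_f[of m] c(2) by auto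
    then obtain t where t: "c < norm (apply_bcontfun (f m) t)"
      by (auto simp: not_le)
    let ?g = "\<lambda>n. x n * apply_bcontfun (f n) t"
    have "d m < norm (apply_bcontfun (f m) t)"
      using t c by simp
    then have "norm (sum ?g (S - {m})) \<le> M * \<epsilon>"
      using assms M small_off by (intro sum_norm_small_le) auto
    moreover have "sum ?g S = ?g m + sum ?g (S - {m})"
      using assms(1,2) by (rule sum.remove)
    moreover have "norm (sum ?g S) \<le> ?N"
      using norm_bounded[of "\<Sum>n\<in>S. kscale (x n) (f n)" t]
      by (simp add: apply_bcontfun_sum apply_bcontfun_kscale)
    moreover have "norm (x m) * c \<le> norm (?g m)"
      using t by (simp add: norm_mult mult_left_mono)
    ultimately show ?thesis
      using norm_diff_ineq[of "?g m" "sum ?g (S - {m})"] by simp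
  qed
  \<comment> \<open>Now \<open>c\<close> tends to 1 from the left; \<open>d m < 1\<close> makes the
    admissible \<open>c\<close> a left neighbourhood of 1.\<close>
  have "((\<lambda>c. norm (x m) * c) \<longlongrightarrow> norm (x m) * 1) (at_left 1)"
    by (intro tendsto_intros)
  moreover have "\<forall>\<^sub>F c in at_left 1. norm (x m) * c \<le> ?N + M * \<epsilon>"
    using eventually_at_left_real[OF d_less[of m]] by eventually_elim (use * in auto)
  ultimately have "norm (x m) * 1 \<le> ?N + M * \<epsilon>"
    by (rule tendsto_upperbound) simp
  then show ?thesis
    by simp
qed

section \<open>The embedding of \<open>c0\<close> and its bounds\<close>

text \<open>The value is meaningful on \<open>c0\<close>; for other \<open>x\<close> the series need
  not converge.\<close>

definition embedding :: "(nat \<Rightarrow>\<^sub>C 'k) \<Rightarrow> 'a \<Rightarrow>\<^sub>C 'k" where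
  "embedding x = (\<Sum>n. kscale (apply_bcontfun x n) (f n))"

text \<open>The terms have norm \<open>norm (x n)\<close>, so convergence need not be absolute;
  instead \<open>norm_sum_le\<close> bounds a block by the largest coefficient in it, which tends to
  0.\<close>

lemma embedding_sums:
  assumes "x \<in> c0"
  shows "(\<lambda>n. kscale (apply_bcontfun x n) (f n)) sums embedding x"
proof -
  let ?g = "\<lambda>n. kscale (apply_bcontfun x n) (f n)"
  have "Cauchy (\<lambda>n. sum ?g {..<n})"
  proof (rule CauchyI')
    fix e :: real
    assume e: "e > 0"
    \<comment> \<open>Chosen so that \<open>(1 + \<epsilon>) * r\<close> is \<open>e / 2\<close>,
      which turns the non-strict block bound into a strict one.\<close>
    define r where "r = e / (2 * (1 + \<epsilon>))"
    have "(1 + \<epsilon>) * r = e / 2"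
      using \<epsilon>_nonneg by (simp add: r_def divide_simps)
    then have r: "r > 0" "(1 + \<epsilon>) * r < e"
      using e \<epsilon>_nonneg by (auto simp: r_def)
    obtain N where N: "\<And>n. n \<ge> N \<Longrightarrow> norm (apply_bcontfun x n) < r"
      using assms LIMSEQ_D[of "apply_bcontfun x" 0 r] r(1) by (auto simp: c0_def)
    have "dist (sum ?g {..<m}) (sum ?g {..<n}) < e" if "m \<ge> N" "m < n" for m n
    proof -
      have "{..<n} - {..<m} = {m..<n}"
        by auto
      then have "sum ?g {..<n} - sum ?g {..<m} = sum ?g {m..<n}"
        using that sum_diff[of "{..<n}" "{..<m}" ?g] by auto
      moreover have "norm (sum ?g {m..<n}) \<le> (1 + \<epsilon>) * r"
        using that N r(1) by (intro norm_sum_le) (auto intro: less_imp_le)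
      ultimately show ?thesis
        using r(2) by (simp add: dist_norm norm_minus_commute[of "sum ?g {..<m}"])
    qed
    then show "\<exists>N. \<forall>m\<ge>N. \<forall>n>m. dist (sum ?g {..<m}) (sum ?g {..<n}) < e"
      by blast
  qed
  then show ?thesis
    unfolding embedding_def using Cauchy_convergent_bcontfun summable_iff_convergent summable_sums
    by blast
qed

lemma norm_embedding_le:
  assumes "x \<in> c0"
  shows "norm (embedding x) \<le> (1 + \<epsilon>) * norm x"
proof (rule LIMSEQ_le_const2)
  show "(\<lambda>N. norm (\<Sum>n<N. kscale (apply_bcontfun x n) (f n))) \<longlonglongrightarrow> norm (embedding x)"
    using embedding_sums[OF assms] unfolding sums_def by (rule tendsto_norm)
  show "\<exists>N0. \<forall>N\<ge>N0. norm (\<Sum>n<N. kscale (apply_bcontfun x n) (f n)) \<le> (1 + \<epsilon>) * norm x"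
    by (intro exI allI impI norm_sum_le) (auto simp: norm_bounded)
qed

lemma norm_embedding_ge:
  assumes "x \<in> c0"
  shows "(1 - \<epsilon>) * norm x \<le> norm (embedding x)"
proof -
  have "norm x \<le> norm (embedding x) + norm x * \<epsilon>"
  proof (rule norm_bound)
    fix m
    have "norm (apply_bcontfun x m) - norm x * \<epsilon> \<le> norm (embedding x)"
    proof (rule LIMSEQ_le_const)
      show "(\<lambda>N. norm (\<Sum>n<N. kscale (apply_bcontfun x n) (f n))) \<longlonglongrightarrow> norm (embedding x)"
        using embedding_sums[OF assms] unfolding sums_def by (rule tendsto_norm)
      show "\<exists>N0. \<forall>N\<ge>N0. norm (apply_bcontfun x m) - norm x * \<epsilon> \<le> norm (\<Sum>n<N. kscale (apply_bcontfun x n) (f n))"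
        \<comment> \<open>The index \<open>m\<close> lies in \<open>{..<N}\<close> only from
          \<open>N = Suc m\<close> on.\<close>
        by (intro exI[of _ "Suc m"] allI impI norm_sum_ge) (auto simp: norm_bounded)
    qed
    then show "norm (apply_bcontfun x m) \<le> norm (embedding x) + norm x * \<epsilon>"
      by simp
  qed
  then show ?thesis
    by (simp add: algebra_simps)
qed

lemma embedding_add:
  assumes "x \<in> c0" "y \<in> c0"
  shows "embedding (x + y) = embedding x + embedding y"
  using sums_unique[OF sums_add[OF assms[THEN embedding_sums]]]
  by (simp add: embedding_def kscale.scale_left_distrib)

lemma embedding_kscale:
  assumes "x \<in> c0"
  shows "embedding (kscale c x) = kscale c (embedding x)"
  using sums_unique[OF bounded_linear.sums[OF bounded_linear_kscale[of c] embedding_sums[OF assms]]]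
  by (simp add: embedding_def apply_bcontfun_kscale)

text \<open>The norm bounds applied to \<open>x - y\<close>.\<close>

lemma dist_embedding:
  assumes "x \<in> c0" "y \<in> c0"
  shows "(1 - \<epsilon>) * dist x y \<le> dist (embedding x) (embedding y)"
    and "dist (embedding x) (embedding y) \<le> (1 + \<epsilon>) * dist x y"
proof -
  have xy: "x - y \<in> c0"
    using assms by (rule kscale.subspace_diff[OF subspace_c0])
  have "embedding x = embedding (x - y) + embedding y"
    using embedding_add[OF xy assms(2)] by simp
  then show "(1 - \<epsilon>) * dist x y \<le> dist (embedding x) (embedding y)"
    and "dist (embedding x) (embedding y) \<le> (1 + \<epsilon>) * dist x y"
    using norm_embedding_le[OF xy] norm_embedding_ge[OF xy] by (simp_all add: dist_norm)
qed

section \<open>The range as a closed subspace\<close>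

lemma subspace_range_embedding: "kscale.subspace (embedding ` c0)"
proof (rule kscale.subspaceI)
  have "embedding 0 = 0"
    by (simp add: embedding_def)
  then show "0 \<in> embedding ` c0"
    by (metis image_eqI kscale.subspace_0 subspace_c0)
next
  fix u v
  assume "u \<in> embedding ` c0" "v \<in> embedding ` c0"
  then show "u + v \<in> embedding ` c0"
    by (auto simp flip: embedding_add intro!: imageI kscale.subspace_add[OF subspace_c0])
next
  fix c u
  assume "u \<in> embedding ` c0"
  then show "kscale c u \<in> embedding ` c0"
    by (auto simp flip: embedding_kscale intro!: imageI kscale.subspace_scale[OF subspace_c0])
qed

text \<open>The lower bound makes preimages of a convergent sequence Cauchy; the upper bound carries
  their limit back to \<open>l\<close>.\<close>

lemma closed_range_embedding: "closed (embedding ` c0)"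
  unfolding closed_sequential_limits
proof (intro allI impI)
  fix F l
  assume F: "(\<forall>n. F n \<in> embedding ` c0) \<and> F \<longlonglongrightarrow> l"
  then obtain x where x: "\<And>n. x n \<in> c0" "\<And>n. F n = embedding (x n)"
    unfolding image_iff by metis
  have "Cauchy x"
    unfolding Cauchy_def
  proof (intro allI impI)
    fix e :: real
    assume "e > 0"
    then have "(1 - \<epsilon>) * e > 0"
      using \<epsilon>_less by simp
    moreover have "Cauchy F"
      using F by (blast intro: LIMSEQ_imp_Cauchy)
    ultimately obtain N where N: "\<And>m n. m \<ge> N \<Longrightarrow> n \<ge> N \<Longrightarrow> dist (F m) (F n) < (1 - \<epsilon>) * e"
      unfolding Cauchy_def by blast
    have "dist (x m) (x n) < e" if "m \<ge> N" "n \<ge> N" for m n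
    proof -
      have "(1 - \<epsilon>) * dist (x m) (x n) < (1 - \<epsilon>) * e"
        using dist_embedding(1)[OF x(1) x(1), of m n] N[OF that] x(2) by simp
      then show ?thesis
        using \<epsilon>_less by simp
    qed
    then show "\<exists>N. \<forall>m\<ge>N. \<forall>n\<ge>N. dist (x m) (x n) < e"
      by blast
  qed
  then obtain y where y: "x \<longlonglongrightarrow> y"
    using Cauchy_convergent_bcontfun convergent_def by blast
  then have "y \<in> c0"
    by (rule closed_sequentially[OF closed_c0 x(1)])
  have "(\<lambda>n. (1 + \<epsilon>) * dist (x n) y) \<longlonglongrightarrow> 0"
    by (intro tendsto_mult_right_zero iffD1[OF tendsto_dist_iff y])
  then have "(\<lambda>n. dist (F n) (embedding y)) \<longlonglongrightarrow> 0"
    by (rule tendsto_sandwich[OF _ _ tendsto_const, rotated 2])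
      (auto simp: x(2) dist_embedding(2) x(1) \<open>y \<in> c0\<close>)
  then have "F \<longlonglongrightarrow> embedding y"
    by (rule iffD2[OF tendsto_dist_iff])
  then show "l \<in> embedding ` c0"
    using F \<open>y \<in> c0\<close> LIMSEQ_unique by blast
qed

text \<open>The partial sums lie in \<open>A\<close>, and \<open>A\<close> contains their
  limit.\<close>

lemma range_embedding_subset:
  assumes "closed A" "kscale.subspace A" "\<And>n. f n \<in> A"
  shows "embedding ` c0 \<subseteq> A"
proof (rule image_subsetI)
  fix x :: "nat \<Rightarrow>\<^sub>C 'k"
  assume "x \<in> c0"
  then have "(\<lambda>N. \<Sum>n<N. kscale (apply_bcontfun x n) (f n)) \<longlonglongrightarrow> embedding x"
    using embedding_sums sums_def by blast
  moreover have "(\<Sum>n<N. kscale (apply_bcontfun x n) (f n)) \<in> A" for N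
    by (intro kscale.subspace_sum[OF assms(2)] kscale.subspace_scale[OF assms(2)] assms(3))
  ultimately show "embedding x \<in> A"
    by (intro closed_sequentially[OF assms(1), where l = "embedding x"])
qed

lemma eps_isometry_embedding: "eps_isometry \<epsilon> c0 (embedding ` c0) embedding"
  by (simp add: eps_isometry_def embedding_add embedding_kscale norm_embedding_le norm_embedding_ge)

end

section \<open>Application to somewhat regular subspaces\<close>

text \<open>Generic in the scalar field, so that the real and the complex case share one
  proof.\<close>

theorem somewhat_regular_eps_isometry_c0:
  fixes A :: "('a::t2_space \<Rightarrow>\<^sub>C 'k::{real_normed_field, banach}) set"
  assumes "infinite (UNIV :: 'a set)" "somewhat_regular A" "closed_linear_subspace_of A C0"
    and \<epsilon>: "0 < \<epsilon>" "\<epsilon> < 1"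
  shows "\<exists>Y T. closed_linear_subspace_of Y A \<and> eps_isometry \<epsilon> c0 Y T"
proof -
  obtain V :: "nat \<Rightarrow> 'a set"
    where V: "\<And>n. open (V n)" "\<And>n. V n \<noteq> {}" "disjoint_family V"
    using infinite_disjoint_open_sets[OF assms(1)] by blast
  \<comment> \<open>The exponent \<open>Suc n\<close> makes the thresholds sum to exactly
    \<epsilon>.\<close>
  define d where "d n = \<epsilon> * (1 / 2) ^ Suc n" for n
  have d: "0 < d n" "d n < 1" for n
  proof -
    show "0 < d n"
      using \<epsilon> by (simp add: d_def)
    have "d n \<le> \<epsilon> * 1"
      unfolding d_def using \<epsilon> by (intro mult_left_mono power_le_one) auto
    then show "d n < 1"
      using \<epsilon> by simp
  qed
  have "\<exists>g\<in>A. norm g = 1 \<and> (\<forall>t. t \<notin> V n \<longrightarrow> norm (apply_bcontfun g t) \<le> d n)" for n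
    using assms(2) V(1,2)[of n] d[of n] by (simp add: somewhat_regular_def)
  then obtain f where f: "\<And>n. f n \<in> A" "\<And>n. norm (f n) = 1"
    "\<And>n t. t \<notin> V n \<Longrightarrow> norm (apply_bcontfun (f n) t) \<le> d n"
    by metis
  interpret almost_disjoint f d \<epsilon>
  proof
    show "d sums \<epsilon>"
      using sums_mult[OF power_half_series, of \<epsilon>] by (simp add: d_def[abs_def])
    show "m = n" if "d m < norm (apply_bcontfun (f m) t)" "d n < norm (apply_bcontfun (f n) t)" for m n t
    proof -
      \<comment> \<open>A value above the threshold \<open>d n\<close> occurs only inside
        \<open>V n\<close>, and the sets \<open>V n\<close> are disjoint.\<close>
      have "t \<in> V m" "t \<in> V n"
        using that f(3) not_less by blast+
      then show ?thesis
        using V(3) by (auto simp: disjoint_family_on_def)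
    qed
  qed (use d f \<epsilon> in \<open>auto intro: less_imp_le\<close>)
  \<comment> \<open>\<open>A\<close> is closed in \<open>C0\<close>, which is itself closed, so
    limits in the ambient space stay in \<open>A\<close>.\<close>
  have A: "closed A" "kscale.subspace A"
    using assms(3) closed_C0 closedin_closed_trans
    unfolding closed_linear_subspace_of_def linear_subspace_of_def by blast+
  have "embedding ` c0 \<subseteq> A"
    using A f(1) by (rule range_embedding_subset)
  then have "closed_linear_subspace_of (embedding ` c0) A"
    by (simp add: closed_linear_subspace_of_def linear_subspace_of_def subspace_range_embedding
        closed_range_embedding closed_subset)
  then show ?thesis
    using eps_isometry_embedding by blast
qed

theorem theorem3p1:
  assumes "infinite (UNIV :: 'a::t2_space set)"
    and "locally_compact_space (euclidean :: 'a topology)"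
  shows
    "(\<forall>(A :: ('a \<Rightarrow>\<^sub>C real) set) \<epsilon>.
        somewhat_regular A \<and> closed_linear_subspace_of A C0 \<and> 0 < \<epsilon> \<and> \<epsilon> < 1 \<longrightarrow>
        (\<exists>Y T. closed_linear_subspace_of Y A \<and> eps_isometry \<epsilon> c0 Y T)) \<and>
     (\<forall>(A :: ('a \<Rightarrow>\<^sub>C complex) set) \<epsilon>.
        somewhat_regular A \<and> closed_linear_subspace_of A C0 \<and> 0 < \<epsilon> \<and> \<epsilon> < 1 \<longrightarrow>
        (\<exists>Y T. closed_linear_subspace_of Y A \<and> eps_isometry \<epsilon> c0 Y T))"
  by (intro conjI allI impI; elim conjE;
      rule somewhat_regular_eps_isometry_c0[OF assms(1)]; assumption)

end
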